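(* Let $(P,\preceq)$ be a finite partially ordered set (of dimensional properties). Then $(P,\preceq)$ has a consistent evaluator if and only if there is a partition $\mathcal{A}$ of $P$ into $N=|\mathcal{A}|$ maximal antichains such that: 1. (Rank criterion) the antichains in $\mathcal{A}$ can be assigned distinct ranks $r:\mathcal{A}\to\mathbb{N}$ respecting the partial order, i.e. whenever $p\in A\in\mathcal{A}$, $q\in B\in\mathcal{A}$ and $p\prec q$, one has $r(A)<r(B)$; 2. (Maximal chain criterion) for every $p\in P$ there exists a maximal chain of $P$ of length $N$ containing $p$.
   Context: "Dimensional properties" are simply the elements of the set $P$. Write $x\prec y$ for $x\preceq y$ and $x\ne y$. A chain (antichain) is a subset in which any two distinct elements are comparable (incomparable); it is maximal if it is not a proper subset of another chain (antichain). The length of a chain is its number of elements. The blocks of a partition are nonempty. Consistent evaluator: a consistent evaluator for a poset $(P,\preceq)$ is a function $f:2^{P}\to T$, where $T$ is a totally ordered set with order $\le$, such that for all subsets $P_1,P_2\subseteq P$: (1) $P_1\neq\varnothing \Rightarrow f(\varnothing)<f(P_1)$; (2) if $p_1\in P_1$, $p_2\in P_2$ and $f(\{p_1\})=f(\{p_2\})$, then $f(P_1)\le f(P_2)$ implies $f(P_1\setminus\{p_1\})\le f(P_2\setminus\{p_2\})$; (3) (for $P_1,P_2$ nonempty, so that the maxima exist) if $f(\{p_1\})\neq f(\{p_2\})$ for all $p_1\in P_1$, $p_2\in P_2$, then $\max_{p\in P_1}f(\{p\})<\max_{q\in P_2}f(\{q\})$ implies $f(P_1)<f(P_2)$; and for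 all $p_1,p_2\in P$: (4) $p_1\prec p_2\Rightarrow f(\{p_1\})<f(\{p_2\})$; (5) if $\{p_1,p_2\}$ is an antichain and $f(\{p_1\})<f(\{p_2\})$, then there exist $s,t\in P$ with $p_1\prec s$, $f(\{s\})=f(\{p_2\})$, $f(\{t\})=f(\{p_1\})$ and $t\prec p_2$. *)

theory Defs
  imports "HOL-Library.Disjoint_Sets"
begin

(* A poset is a carrier P with a relation le satisfying partial_order_on P le;
   its strict part is le - Id, as in HOL.Order_Relation. *)

definition antichain_on :: "'a set \<Rightarrow> 'a rel \<Rightarrow> 'a set \<Rightarrow> bool" where
  "antichain_on P le A \<longleftrightarrow>
     A \<subseteq> P \<and> (\<forall>x\<in>A. \<forall>y\<in>A. x \<noteq> y \<longrightarrow> (x, y) \<notin> le \<and> (y, x) \<notin> le)"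

definition max_antichain_on :: "'a set \<Rightarrow> 'a rel \<Rightarrow> 'a set \<Rightarrow> bool" where
  "max_antichain_on P le A \<longleftrightarrow>
     antichain_on P le A \<and> \<not> (\<exists>B. antichain_on P le B \<and> A \<subset> B)"

(* pred_on.maxchain compares elements with the reflexive closure of the given
   predicate, so passing the reflexive order le is harmless. *)
abbreviation max_chain_on :: "'a set \<Rightarrow> 'a rel \<Rightarrow> 'a set \<Rightarrow> bool" where
  "max_chain_on P le \<equiv> pred_on.maxchain P (\<lambda>x y. (x, y) \<in> le)"

(* The totally ordered set of values is a type of class linorder; only the values
   of f on subsets of P matter. HOL cannot quantify over that type inside a formula, so
   an equivalence with the existence of an evaluator has to be stated as two
   implications: from an evaluator into any linorder type, and to one into a concrete
   type such as nat. In the third clause Max is applied to finite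
   nonempty sets whenever P is finite. *)
definition consistent_evaluator ::
  "'a set \<Rightarrow> 'a rel \<Rightarrow> ('a set \<Rightarrow> 't::linorder) \<Rightarrow> bool" where
  "consistent_evaluator P le f \<longleftrightarrow>
     (\<forall>P1 \<subseteq> P. P1 \<noteq> {} \<longrightarrow> f {} < f P1) \<and>
     (\<forall>P1 \<subseteq> P. \<forall>P2 \<subseteq> P. \<forall>p1 \<in> P1. \<forall>p2 \<in> P2.
        f {p1} = f {p2} \<longrightarrow> f P1 \<le> f P2 \<longrightarrow> f (P1 - {p1}) \<le> f (P2 - {p2})) \<and>
     (\<forall>P1 \<subseteq> P. \<forall>P2 \<subseteq> P. P1 \<noteq> {} \<longrightarrow> P2 \<noteq> {} \<longrightarrow>
        (\<forall>p1 \<in> P1. \<forall>p2 \<in> P2. f {p1} \<noteq> f {p2}) \<longrightarrow>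
        Max ((\<lambda>p. f {p}) ` P1) < Max ((\<lambda>q. f {q}) ` P2) \<longrightarrow> f P1 < f P2) \<and>
     (\<forall>p1 \<in> P. \<forall>p2 \<in> P. (p1, p2) \<in> le - Id \<longrightarrow> f {p1} < f {p2}) \<and>
     (\<forall>p1 \<in> P. \<forall>p2 \<in> P. antichain_on P le {p1, p2} \<longrightarrow> f {p1} < f {p2} \<longrightarrow>
        (\<exists>s \<in> P. \<exists>t \<in> P. (p1, s) \<in> le - Id \<and> f {s} = f {p2} \<and>
                        f {t} = f {p1} \<and> (t, p2) \<in> le - Id))"

definition rank_criterion :: "'a rel \<Rightarrow> 'a set set \<Rightarrow> bool" where
  "rank_criterion le \<A> \<longleftrightarrow>
     (\<exists>rank :: 'a set \<Rightarrow> nat. inj_on rank \<A> \<and>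
        (\<forall>A \<in> \<A>. \<forall>B \<in> \<A>. \<forall>p \<in> A. \<forall>q \<in> B. (p, q) \<in> le - Id \<longrightarrow> rank A < rank B))"

definition maximal_chain_criterion :: "'a set \<Rightarrow> 'a rel \<Rightarrow> nat \<Rightarrow> bool" where
  "maximal_chain_criterion P le N \<longleftrightarrow>
     (\<forall>p \<in> P. \<exists>C. max_chain_on P le C \<and> card C = N \<and> p \<in> C)"

definition ranked_antichain_partition :: "'a set \<Rightarrow> 'a rel \<Rightarrow> 'a set set \<Rightarrow> bool" where
  "ranked_antichain_partition P le \<A> \<longleftrightarrow>
     partition_on P \<A> \<and> (\<forall>A \<in> \<A>. max_antichain_on P le A) \<and>
     rank_criterion le \<A> \<and> maximal_chain_criterion P le (card \<A>)"

end

theory Submission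
  imports Defs
begin

text \<open>
  For the forward direction, the blocks are the level sets of \<open>p \<mapsto> f {p}\<close>. Clauses (4) and (5)
  together say that from an element at level \<open>v\<close> one can go strictly up (down) in the order to any
  level \<open>w > v\<close> (\<open>w < v\<close>); this makes the level sets maximal antichains, and going through the
  levels consecutively yields a chain meeting all of them.

  Conversely, with \<open>r p\<close> the rank of the block of \<open>p\<close> and \<open>b > card P\<close>, the evaluator
  \<open>X \<mapsto> \<Sum>p\<in>X. b ^ r p\<close> compares sets lexicographically from the highest rank downwards. Clause (5)
  holds because a chain of length \<open>N\<close> meets each of the \<open>N\<close> antichains exactly once.
\<close>

section \<open>Chains built level by level\<close>

lemma chain_on_iff:
  "pred_on.chain P (\<lambda>x y. (x, y) \<in> le) C \<longleftrightarrow>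
     C \<subseteq> P \<and> (\<forall>x\<in>C. \<forall>y\<in>C. x \<noteq> y \<longrightarrow> (x, y) \<in> le \<or> (y, x) \<in> le)"
  unfolding pred_on.chain_def by auto

text \<open>The order \<open>L\<close> on levels is a parameter so that the lemma applies both upwards and downwards.\<close>

lemma chain_through_levels:
  assumes "trans R"
    and step: "\<And>p w. p \<in> P \<Longrightarrow> w \<in> W \<Longrightarrow> L (g p) w \<Longrightarrow> \<exists>s\<in>P. (p, s) \<in> R \<and> g s = w"
    and "p \<in> P" "set ws \<subseteq> W" "sorted_wrt L (g p # ws)"
  shows "\<exists>D\<subseteq>P. (\<forall>x\<in>D. (p, x) \<in> R) \<and> g ` D = set ws \<and>
           (\<forall>x\<in>D. \<forall>y\<in>D. x \<noteq> y \<longrightarrow> (x, y) \<in> R \<or> (y, x) \<in> R)"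
  using assms(3-)
proof (induction ws arbitrary: p)
  case Nil
  show ?case by (intro exI[of _ "{}"]) simp
next
  case (Cons w ws)
  then obtain s where s: "s \<in> P" "(p, s) \<in> R" "g s = w"
    using step[of p w] by auto
  then obtain D where D: "D \<subseteq> P" "\<forall>x\<in>D. (s, x) \<in> R" "g ` D = set ws"
      "\<forall>x\<in>D. \<forall>y\<in>D. x \<noteq> y \<longrightarrow> (x, y) \<in> R \<or> (y, x) \<in> R"
    using Cons.IH[of s] Cons.prems by auto
  \<comment> \<open>The chain \<open>D\<close> from the induction starts at \<open>s\<close>;
    transitivity through \<open>s\<close> relates \<open>p\<close> to all of it, so \<open>s\<close>
    can be put in front.\<close>
  have "\<forall>x\<in>D. (p, x) \<in> R"
    using D(2) s(2) \<open>trans R\<close> by (meson transD)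
  with s D show ?case
    by (intro exI[of _ "insert s D"]) auto
qed

locale finite_poset =
  fixes P :: "'a set" and le :: "'a rel"
  assumes fin: "finite P" and po: "partial_order_on P le"
begin

lemma trans_le: "trans le"
  using po by (simp add: partial_order_on_def preorder_on_def)

section \<open>From an evaluator to a ranked partition\<close>

text \<open>Distinct elements of a chain are strictly comparable, so a strictly monotone
  \<open>g\<close> separates them. Hence no chain is longer than the number of levels.\<close>

lemma inj_on_level:
  assumes mono: "\<And>p q. p \<in> P \<Longrightarrow> q \<in> P \<Longrightarrow> (p, q) \<in> le - Id \<Longrightarrow> g p < (g q :: 't :: linorder)"
    and "pred_on.chain P (\<lambda>x y. (x, y) \<in> le) C"
  shows "inj_on g C"
proof (rule inj_onI, rule ccontr)
  fix x y assume "x \<in> C" "y \<in> C" "g x = g y" "x \<noteq> y"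
  then show False
    using assms(2) mono[of x y] mono[of y x] unfolding chain_on_iff by auto
qed

text \<open>Here \<open>g\<close> stands for \<open>p \<mapsto> f {p}\<close>, and \<open>up\<close>
  and \<open>down\<close> are the two halves of clause (5), stated for comparable pairs as
  well.\<close>

lemma partition_of_levels:
  fixes g :: "'a \<Rightarrow> 't :: linorder"
  assumes mono: "\<And>p q. p \<in> P \<Longrightarrow> q \<in> P \<Longrightarrow> (p, q) \<in> le - Id \<Longrightarrow> g p < g q"
    and up: "\<And>p w. p \<in> P \<Longrightarrow> w \<in> g ` P \<Longrightarrow> g p < w \<Longrightarrow> \<exists>s\<in>P. (p, s) \<in> le - Id \<and> g s = w"
    and down: "\<And>p w. p \<in> P \<Longrightarrow> w \<in> g ` P \<Longrightarrow> w < g p \<Longrightarrow> \<exists>t\<in>P. (t, p) \<in> le - Id \<and> g t = w"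
  shows "\<exists>\<A>. ranked_antichain_partition P le \<A>"
proof -
  define level where "level v = {p\<in>P. g p = v}" for v
  define \<A> where "\<A> = level ` g ` P"
  have finW: "finite (g ` P)" using fin by simp
  have inj_level: "inj_on level (g ` P)"
    unfolding inj_on_def level_def by blast
  have card_\<A>: "card \<A> = card (g ` P)"
    unfolding \<A>_def by (rule card_image[OF inj_level])
  have part: "partition_on P \<A>"
    unfolding partition_on_def disjoint_def \<A>_def level_def by auto
  have anti: "max_antichain_on P le A" if A: "A \<in> \<A>" for A
  proof -
    obtain p where p: "p \<in> P" "A = level (g p)"
      using A by (auto simp: \<A>_def)
    have "antichain_on P le A"
      unfolding antichain_on_def p(2) level_def using mono by fastforce
    moreover have False if B: "antichain_on P le B" "A \<subset> B" for B
    proof -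
      obtain q where q: "q \<in> B" "q \<notin> A" using B by blast
      then have "q \<in> P" "g q \<noteq> g p"
        using B p by (auto simp: antichain_on_def level_def)
      \<comment> \<open>Moving from \<open>q\<close> to the level of \<open>p\<close> gives an
        element of \<open>A\<close>, hence of \<open>B\<close>, strictly comparable to
        \<open>q\<close>. This contradicts that \<open>B\<close> is an antichain.\<close>
      then consider "g q < g p" | "g p < g q" by fastforce
      then obtain s where "s \<in> P" "g s = g p" "(q, s) \<in> le - Id \<or> (s, q) \<in> le - Id"
        using up[of q "g p"] down[of q "g p"] p \<open>q \<in> P\<close> by cases blast+
      moreover from this have "s \<in> B"
        using p B by (auto simp: level_def)
      ultimately show False
        using B q unfolding antichain_on_def by blast
    qed
    ultimately show ?thesis unfolding max_antichain_on_def by blast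
  qed
  have rank: "rank_criterion le \<A>"
    unfolding rank_criterion_def
  \<comment> \<open>Values of \<open>g\<close> lie in an arbitrary linear order, so the rank of a
    block is the number of values below its own. Quantifying over \<open>A\<close> avoids choosing a
    representative.\<close>
  proof (intro exI[of _ "\<lambda>A. card {w \<in> g ` P. \<forall>p\<in>A. w < g p}"] conjI)
    have eq: "{w \<in> g ` P. \<forall>p\<in>level v. w < g p} = {w \<in> g ` P. w < v}" if "v \<in> g ` P" for v
      using that by (auto simp: level_def)
    have less: "card {w \<in> g ` P. w < v} < card {w \<in> g ` P. w < u}"
      if "v \<in> g ` P" "v < u" for u v
      by (rule psubset_card_mono) (use that finW in auto)
    show "inj_on (\<lambda>A. card {w \<in> g ` P. \<forall>p\<in>A. w < g p}) \<A>"
    proof (rule inj_onI)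
      fix A B assume AB: "A \<in> \<A>" "B \<in> \<A>"
        and card: "card {w \<in> g ` P. \<forall>p\<in>A. w < g p} = card {w \<in> g ` P. \<forall>p\<in>B. w < g p}"
      obtain u v where uv: "u \<in> g ` P" "v \<in> g ` P" "A = level u" "B = level v"
        using AB by (auto simp: \<A>_def)
      with card have "card {w \<in> g ` P. w < u} = card {w \<in> g ` P. w < v}"
        by (simp add: eq)
      with less[of u v] less[of v u] uv have "u = v"
        by (cases u v rule: linorder_cases) auto
      with uv show "A = B" by simp
    qed
    show "\<forall>A\<in>\<A>. \<forall>B\<in>\<A>. \<forall>p\<in>A. \<forall>q\<in>B. (p, q) \<in> le - Id \<longrightarrow>
            card {w \<in> g ` P. \<forall>p\<in>A. w < g p} < card {w \<in> g ` P. \<forall>p\<in>B. w < g p}"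
    proof (intro ballI impI)
      fix A B p q assume *: "A \<in> \<A>" "B \<in> \<A>" "p \<in> A" "q \<in> B" "(p, q) \<in> le - Id"
      then have pq: "p \<in> P" "q \<in> P" "A = level (g p)" "B = level (g q)"
        by (auto simp: \<A>_def level_def)
      with * mono have "g p < g q" by blast
      with less[of "g p" "g q"] pq
      show "card {w \<in> g ` P. \<forall>p\<in>A. w < g p} < card {w \<in> g ` P. \<forall>p\<in>B. w < g p}"
        by (simp add: eq)
    qed
  qed
  have chain: "maximal_chain_criterion P le (card \<A>)"
    unfolding maximal_chain_criterion_def
  proof
    fix p assume p: "p \<in> P"
    let ?us = "sorted_list_of_set {w \<in> g ` P. g p < w}"
    \<comment> \<open>The list is reversed because the lower half of the chain is built from
      \<open>p\<close> downwards, one level at a time.\<close>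
    let ?ds = "rev (sorted_list_of_set {w \<in> g ` P. w < g p})"
    have us: "set ?us = {w \<in> g ` P. g p < w}" and ds: "set ?ds = {w \<in> g ` P. w < g p}"
      using finW by simp_all
    have "\<exists>D\<subseteq>P. (\<forall>x\<in>D. (p, x) \<in> le) \<and> g ` D = set ?us \<and>
           (\<forall>x\<in>D. \<forall>y\<in>D. x \<noteq> y \<longrightarrow> (x, y) \<in> le \<or> (y, x) \<in> le)"
    proof (rule chain_through_levels[where L = "(<)" and W = "g ` P"])
      show "sorted_wrt (<) (g p # ?us)" using finW by simp
    qed (use trans_le up p finW in auto)
    then obtain U where U: "U \<subseteq> P" "\<forall>x\<in>U. (p, x) \<in> le" "g ` U = {w \<in> g ` P. g p < w}"
        "\<forall>x\<in>U. \<forall>y\<in>U. x \<noteq> y \<longrightarrow> (x, y) \<in> le \<or> (y, x) \<in> le"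
      unfolding us by meson
    have "\<exists>D\<subseteq>P. (\<forall>x\<in>D. (p, x) \<in> le\<inverse>) \<and> g ` D = set ?ds \<and>
           (\<forall>x\<in>D. \<forall>y\<in>D. x \<noteq> y \<longrightarrow> (x, y) \<in> le\<inverse> \<or> (y, x) \<in> le\<inverse>)"
    proof (rule chain_through_levels[where L = "(>)" and W = "g ` P"])
      show "sorted_wrt (>) (g p # ?ds)" using finW by (simp add: sorted_wrt_rev)
      show "\<exists>s\<in>P. (p, s) \<in> le\<inverse> \<and> g s = w" if "p \<in> P" "w \<in> g ` P" "g p > w" for p w
        using down[OF that] by auto
    qed (use trans_le p finW in auto)
    then obtain D where D: "D \<subseteq> P" "\<forall>x\<in>D. (x, p) \<in> le" "g ` D = {w \<in> g ` P. w < g p}"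
        "\<forall>x\<in>D. \<forall>y\<in>D. x \<noteq> y \<longrightarrow> (x, y) \<in> le \<or> (y, x) \<in> le"
      unfolding ds converse_iff by meson
    define C where "C = insert p (U \<union> D)"
    \<comment> \<open>The two halves are glued at \<open>p\<close>: everything in \<open>D\<close>
      lies below \<open>p\<close>, everything in \<open>U\<close> above.\<close>
    have DU: "\<forall>x\<in>D. \<forall>y\<in>U. (x, y) \<in> le"
      using U(2) D(2) trans_le by (meson transD)
    have C: "pred_on.chain P (\<lambda>x y. (x, y) \<in> le) C"
      unfolding chain_on_iff C_def ball_simps ball_Un using U(1,2,4) D(1,2,4) p DU by simp
    have "g ` C = g ` P"
      unfolding C_def image_insert image_Un U(3) D(3) using p by auto
    then have card_C: "card C = card (g ` P)"
      using card_image[OF inj_on_level[where g = g, OF mono C]] by simp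
    \<comment> \<open>Maximality follows by counting: \<open>g\<close> is injective on any chain,
      and \<open>C\<close> already has as many elements as there are levels.\<close>
    have "\<not> C \<subset> C'" if C': "pred_on.chain P (\<lambda>x y. (x, y) \<in> le) C'" for C'
    proof
      assume "C \<subset> C'"
      have C'P: "C' \<subseteq> P" using C' by (simp add: chain_on_iff)
      then have "card C < card C'"
        using \<open>C \<subset> C'\<close> fin by (meson finite_subset psubset_card_mono)
      also have "\<dots> = card (g ` C')"
        using card_image[OF inj_on_level[where g = g, OF mono C']] by simp
      also have "\<dots> \<le> card (g ` P)"
        using C'P finW by (intro card_mono image_mono)
      finally show False using card_C by simp
    qed
    with C have "max_chain_on P le C"
      unfolding pred_on.maxchain_def by blast
    then show "\<exists>C. max_chain_on P le C \<and> card C = card \<A> \<and> p \<in> C"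
      using card_C card_\<A> by (auto simp: C_def)
  qed
  from part anti rank chain show ?thesis
    unfolding ranked_antichain_partition_def by blast
qed

lemma evaluator_imp_partition:
  fixes f :: "'a set \<Rightarrow> 't :: linorder"
  assumes "consistent_evaluator P le f"
  shows "\<exists>\<A>. ranked_antichain_partition P le \<A>"
proof (rule partition_of_levels[where g = "\<lambda>p. f {p}"])
  show mono: "f {p} < f {q}" if "p \<in> P" "q \<in> P" "(p, q) \<in> le - Id" for p q
    using assms that unfolding consistent_evaluator_def by blast
  \<comment> \<open>For comparable elements the witnesses are \<open>s = q\<close> and
    \<open>t = p\<close>, since clause (4) forces \<open>p\<close> to lie below
    \<open>q\<close>.\<close>
  have five: "\<exists>s\<in>P. \<exists>t\<in>P. (p, s) \<in> le - Id \<and> f {s} = f {q} \<and> f {t} = f {p} \<and> (t, q) \<in> le - Id"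
    if "p \<in> P" "q \<in> P" "f {p} < f {q}" for p q
  proof (cases "antichain_on P le {p, q}")
    case True
    then show ?thesis
      using assms that unfolding consistent_evaluator_def by blast
  next
    case False
    then have "(p, q) \<in> le - Id"
      using that mono[of q p] unfolding antichain_on_def by auto
    with that show ?thesis by blast
  qed
  show "\<exists>s\<in>P. (p, s) \<in> le - Id \<and> f {s} = w"
    if "p \<in> P" "w \<in> (\<lambda>p. f {p}) ` P" "f {p} < w" for p w
    using that five[of p] by blast
  show "\<exists>t\<in>P. (t, p) \<in> le - Id \<and> f {t} = w"
    if "p \<in> P" "w \<in> (\<lambda>p. f {p}) ` P" "w < f {p}" for p w
    using that five[of _ p] by blast
qed

section \<open>From a ranked partition to an evaluator\<close>

text \<open>Pigeonhole: a chain has at most one element in each antichain, so sending elements to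
  their blocks is injective, and by equal cardinality it is onto \<open>\<A>\<close>.\<close>

lemma chain_meets_block:
  assumes part: "partition_on P \<A>" and anti: "\<And>A. A \<in> \<A> \<Longrightarrow> antichain_on P le A"
    and C: "pred_on.chain P (\<lambda>x y. (x, y) \<in> le) C" "card C = card \<A>" and "A \<in> \<A>"
  shows "C \<inter> A \<noteq> {}"
proof -
  have CP: "C \<subseteq> P" using C by (simp add: chain_on_iff)
  have "\<exists>B\<in>\<A>. x \<in> B" if "x \<in> C" for x
    using that CP part by (auto simp: partition_on_def)
  then obtain block where block: "\<And>x. x \<in> C \<Longrightarrow> block x \<in> \<A> \<and> x \<in> block x"
    by metis
  have "inj_on block C"
  proof (rule inj_onI, rule ccontr)
    fix x y assume *: "x \<in> C" "y \<in> C" "block x = block y" "x \<noteq> y"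
    then show False
      using C(1) block[of x] block[of y] anti[of "block x"]
      unfolding chain_on_iff antichain_on_def by metis
  qed
  then have "card (block ` C) = card \<A>" using C(2) by (simp add: card_image)
  moreover have "finite \<A>" using part fin by (simp add: finite_elements)
  ultimately have "block ` C = \<A>"
    using block by (intro card_subset_eq) auto
  then show ?thesis using block \<open>A \<in> \<A>\<close> by auto
qed

text \<open>The assumption \<open>meets\<close> is what the maximal chain criterion supplies: a
  chain through \<open>p\<close> contains an element of the block of \<open>q\<close>.\<close>

lemma evaluator_of_ranks:
  fixes r :: "'a \<Rightarrow> nat"
  assumes mono: "\<And>p q. p \<in> P \<Longrightarrow> q \<in> P \<Longrightarrow> (p, q) \<in> le - Id \<Longrightarrow> r p < r q"
    and meets: "\<And>p q. p \<in> P \<Longrightarrow> q \<in> P \<Longrightarrow> r p \<noteq> r q \<Longrightarrow>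
                  \<exists>s\<in>P. r s = r q \<and> ((p, s) \<in> le \<or> (s, p) \<in> le)"
  shows "\<exists>f :: 'a set \<Rightarrow> nat. consistent_evaluator P le f"
proof -
  \<comment> \<open>The base exceeds the number of summands, so no carry can reach the next power;
    adding 2 keeps \<open>b > 1\<close> even for empty \<open>P\<close>.\<close>
  define b where "b = card P + 2"
  define f where "f X = (\<Sum>p\<in>X. b ^ r p)" for X
  have b: "b > 1" "b > card P" by (auto simp: b_def)
  have f1: "f {p} = b ^ r p" for p by (simp add: f_def)
  have f_less: "f {p} < f {q} \<longleftrightarrow> r p < r q" for p q using b by (simp add: f1)
  have f_eq: "f {p} = f {q} \<longleftrightarrow> r p = r q" for p q using b by (simp add: f1)
  have sub: "finite X" if "X \<subseteq> P" for X using that fin by (rule finite_subset)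
  have f_ge: "f {q} \<le> f X" if "X \<subseteq> P" "q \<in> X" for X q
    unfolding f_def by (rule sum_mono2) (use that sub in auto)
  have c1: "f {} < f X" if X: "X \<subseteq> P" "X \<noteq> {}" for X
  proof -
    obtain q where "q \<in> X" using X by blast
    moreover have "f {} < f {q}" using b unfolding f1 by (simp add: f_def)
    ultimately show ?thesis using f_ge[of X q] X by simp
  qed
  have c2: "f (X - {p}) \<le> f (Y - {q})"
    if "X \<subseteq> P" "Y \<subseteq> P" "p \<in> X" "q \<in> Y" "f {p} = f {q}" "f X \<le> f Y" for X Y p q
  proof -
    \<comment> \<open>By additivity, clause (2) is cancellation of the equal summands
      \<open>f {p}\<close> and \<open>f {q}\<close>.\<close>
    have "f X = f {p} + f (X - {p})" "f Y = f {q} + f (Y - {q})"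
      unfolding f1 unfolding f_def using that sub by (auto simp: sum.remove)
    with that show ?thesis by simp
  qed
  have c3: "f X < f Y"
    if XY: "X \<subseteq> P" "Y \<subseteq> P" "X \<noteq> {}" "Y \<noteq> {}"
      and max: "Max ((\<lambda>p. f {p}) ` X) < Max ((\<lambda>q. f {q}) ` Y)" for X Y
  proof -
    have "Max ((\<lambda>q. f {q}) ` Y) \<in> (\<lambda>q. f {q}) ` Y"
      using XY sub by (intro Max_in) auto
    then obtain q where q: "q \<in> Y" "Max ((\<lambda>q. f {q}) ` Y) = f {q}" by auto
    have "Max ((\<lambda>p. f {p}) ` X) \<in> (\<lambda>p. f {p}) ` X"
      using XY sub by (intro Max_in) auto
    then obtain p where p: "p \<in> X" "Max ((\<lambda>p. f {p}) ` X) = f {p}" by auto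
    have le: "b ^ r x \<le> b ^ r p" if "x \<in> X" for x
      using Max_ge[of "(\<lambda>p. f {p}) ` X" "f {x}"] that sub[OF XY(1)] unfolding p(2) by (simp add: f1)
    \<comment> \<open>With \<open>p\<close> of highest rank in \<open>X\<close>, the whole sum stays
      below \<open>b ^ Suc (r p)\<close>, which a single element \<open>q\<close> of higher rank in
      \<open>Y\<close> attains.\<close>
    have "f X \<le> card X * b ^ r p"
      unfolding f_def using sum_bounded_above[of X "\<lambda>x. b ^ r x" "b ^ r p"] le by simp
    also have "\<dots> \<le> card P * b ^ r p"
      using XY fin by (simp add: card_mono)
    also have "\<dots> < b ^ Suc (r p)" using b by simp
    also have "\<dots> \<le> b ^ r q"
      using max b unfolding p(2) q(2) f_less by (intro power_increasing) auto
    also have "\<dots> \<le> f Y" using f_ge[of Y q] XY q by (simp add: f1)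
    finally show ?thesis .
  qed
  have c4: "f {p} < f {q}" if "p \<in> P" "q \<in> P" "(p, q) \<in> le - Id" for p q
    unfolding f_less using mono[OF that] .
  have c5: "\<exists>s\<in>P. \<exists>t\<in>P. (p, s) \<in> le - Id \<and> f {s} = f {q} \<and> f {t} = f {p} \<and> (t, q) \<in> le - Id"
    if pq: "p \<in> P" "q \<in> P" "f {p} < f {q}" for p q
  proof -
    have less: "r p < r q" using pq by (simp add: f_less)
    obtain s where "s \<in> P" "r s = r q" "(p, s) \<in> le \<or> (s, p) \<in> le"
      using meets[of p q] pq less by auto
    \<comment> \<open>Comparability becomes a direction here: \<open>s\<close> has the rank of
      \<open>q\<close>, which is larger than that of \<open>p\<close>, so \<open>s\<close> cannot
      lie below \<open>p\<close>.\<close>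
    with mono[of s p] pq less have "(p, s) \<in> le - Id" by auto
    moreover obtain t where "t \<in> P" "r t = r p" "(q, t) \<in> le \<or> (t, q) \<in> le"
      using meets[of q p] pq less by auto
    with mono[of q t] pq less have "(t, q) \<in> le - Id" by auto
    ultimately show ?thesis
      unfolding f_eq using \<open>s \<in> P\<close> \<open>t \<in> P\<close> \<open>r s = r q\<close> \<open>r t = r p\<close> by blast
  qed
  have "consistent_evaluator P le f"
    unfolding consistent_evaluator_def
  proof (intro conjI)
    show "\<forall>X\<subseteq>P. X \<noteq> {} \<longrightarrow> f {} < f X" using c1 by simp
  qed (intro allI ballI impI, (rule c2 c3 c4 c5; assumption))+
  then show ?thesis by blast
qed

lemma partition_imp_evaluator:
  assumes "ranked_antichain_partition P le \<A>"
  shows "\<exists>f :: 'a set \<Rightarrow> nat. consistent_evaluator P le f"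
proof -
  from assms have part: "partition_on P \<A>"
    and anti: "\<And>A. A \<in> \<A> \<Longrightarrow> antichain_on P le A"
    and chains: "\<And>p. p \<in> P \<Longrightarrow> \<exists>C. max_chain_on P le C \<and> card C = card \<A> \<and> p \<in> C"
    unfolding ranked_antichain_partition_def maximal_chain_criterion_def max_antichain_on_def
    by auto
  obtain rank :: "'a set \<Rightarrow> nat" where
    rank: "\<And>A B p q. A \<in> \<A> \<Longrightarrow> B \<in> \<A> \<Longrightarrow> p \<in> A \<Longrightarrow> q \<in> B \<Longrightarrow> (p, q) \<in> le - Id \<Longrightarrow> rank A < rank B"
    using assms unfolding ranked_antichain_partition_def rank_criterion_def by meson
  define block where "block p = (THE A. A \<in> \<A> \<and> p \<in> A)" for p
  have block: "block p \<in> \<A> \<and> p \<in> block p" if "p \<in> P" for p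
    unfolding block_def
    by (rule theI') (use that part in \<open>auto simp: partition_on_def disjoint_def\<close>)
  have block_eq: "block p = A" if "A \<in> \<A>" "p \<in> A" for A p
    unfolding block_def
    by (rule the_equality) (use that part in \<open>auto simp: partition_on_def disjoint_def\<close>)
  show ?thesis
  proof (rule evaluator_of_ranks[where r = "\<lambda>p. rank (block p)"])
    show "rank (block p) < rank (block q)" if "p \<in> P" "q \<in> P" "(p, q) \<in> le - Id" for p q
      using that block rank by blast
    show "\<exists>s\<in>P. rank (block s) = rank (block q) \<and> ((p, s) \<in> le \<or> (s, p) \<in> le)"
      if pq: "p \<in> P" "q \<in> P" "rank (block p) \<noteq> rank (block q)" for p q
    proof -
      obtain C where C: "pred_on.chain P (\<lambda>x y. (x, y) \<in> le) C" "card C = card \<A>" "p \<in> C"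
        using chains[OF pq(1)] unfolding pred_on.maxchain_def by blast
      \<comment> \<open>The chain through \<open>p\<close> has length \<open>card \<A>\<close>, so
        it also meets the block of \<open>q\<close>.\<close>
      obtain s where s: "s \<in> C" "s \<in> block q"
        using chain_meets_block[OF part anti C(1,2)] block[OF pq(2)] by blast
      then have "block s = block q" using block block_eq pq by blast
      with s C pq show ?thesis unfolding chain_on_iff by (metis subsetD)
    qed
  qed
qed

end

theorem theorem1:
  fixes P :: "'a set" and le :: "'a rel"
  assumes "finite P" and "partial_order_on P le"
  shows "((\<exists>f :: 'a set \<Rightarrow> 't::linorder. consistent_evaluator P le f)
            \<longrightarrow> (\<exists>\<A>. ranked_antichain_partition P le \<A>)) \<and>
         ((\<exists>\<A>. ranked_antichain_partition P le \<A>)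
            \<longrightarrow> (\<exists>f :: 'a set \<Rightarrow> nat. consistent_evaluator P le f))"
proof -
  interpret finite_poset P le using assms by unfold_locales
  show ?thesis using evaluator_imp_partition partition_imp_evaluator by blast
qed

end
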